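(* Let $\mathcal{H}$ be a real Hilbert space, let $f\in\Gamma_0(\mathcal{H})$ be Legendre, and let $U$ and $L$ be, respectively, a closed affine subspace and a closed linear subspace of $\mathcal{H}$ with $U\cap\operatorname{int}\operatorname{dom} f\neq\varnothing$ and $L\cap\operatorname{int}\operatorname{dom} f\neq\varnothing$. Let $y\in\operatorname{int}\operatorname{dom} f$ and $z\in\mathcal{H}$. Then the following hold. (i) The following three statements are equivalent: (a) $z=\overleftarrow{P}^{f}_{U}(y)$; (b) $z\in U\cap\operatorname{int}\operatorname{dom} f$ and, for every $u\in U$, $\langle\nabla f(y)-\nabla f(z),u-z\rangle=0$; (c) $z\in U\cap\operatorname{int}\operatorname{dom} f$ and, for every $u\in U$, $D_f(u,y)=D_f(u,z)+D_f(z,y)$. (ii) $z=\overleftarrow{P}^{f}_{L}(y)$ if and only if $z\in L\cap\operatorname{int}\operatorname{dom} f$ and $\nabla f(y)-\nabla f(z)\in L^{\perp}$. (iii) Suppose that $\mathcal{H}=\mathbb{R}^n$, that $\operatorname{dom} f^{*}$ is open, and that $f$ allows forward Bregman projections. Then the following three statements are equivalent: (a) $z=\overrightarrow{P}^{f}_{U}(y)$; (b) $z\in U\cap\operatorname{int}\operatorname{dom} f$ and, for every $u\in U$, $\langle u-z,\nabla^2 f(z)(y-z)\rangle=0$; (c) $z\in U\cap\operatorname{int}\operatorname{dom} f$ and, for every $u\in U$, $D_f(u,y)=D_f(u,z)+D_{D_f}\big((u,u),(y,z)\big)$. (iv) Suppose that $\mathcal{H}=\mathbb{R}^n$, that $\operatorname{dom}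 f^{*}$ is open, and that $f$ allows forward Bregman projections. Then $z=\overrightarrow{P}^{f}_{L}(y)$ if and only if $z\in L\cap\operatorname{int}\operatorname{dom} f$ and $\nabla^2 f(z)(y-z)\in L^{\perp}$.
   Context: $\Gamma_0(\mathcal{H})$ is the set of proper closed convex functions $\mathcal{H}\to\,]-\infty,+\infty]$; $f^*$ is the Fenchel conjugate of $f$. A function $f\in\Gamma_0(\mathcal{H})$ is essentially smooth if $\operatorname{dom}\partial f=\operatorname{int}\operatorname{dom} f\neq\varnothing$, $f$ is Gâteaux differentiable on $\operatorname{int}\operatorname{dom} f$, and $\|\nabla f(x_k)\|\to+\infty$ for every sequence $(x_k)$ in $\operatorname{int}\operatorname{dom} f$ converging to some point of $\operatorname{bd}\operatorname{dom} f$. It is essentially strictly convex if $(\partial f)^{-1}$ is locally bounded on its domain (each point has a closed ball around it whose image is bounded) and $f$ is strictly convex on every convex subset of $\operatorname{dom}\partial f$. It is Legendre if it is both essentially smooth and essentially strictly convex. The Bregman distance is $D_f:\mathcal{H}\times\mathcal{H}\to[0,+\infty]$, $D_f(x,y)=f(x)-f(y)-\langle\nabla f(y),x-y\rangle$ if $y\in\operatorname{int}\operatorname{dom} f$, and $D_f(x,y)=+\infty$ otherwise. For a nonempty set $C\subseteq\mathcal{H}$, $y\in\operatorname{int}\operatorname{dom} f$ and $x\in\operatorname{dom} f$, the backward Bregman projection of $y$ onto $C$ is the set $\overleftarrow{P}^{f}_{C}(y)=\{u\in C\cap\operatorname{dom} f:\ (\forall c\in C)\ D_f(u,y)\le D_f(c,y)\}$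 and the forward Bregman projection of $x$ onto $C$ is the set $\overrightarrow{P}^{f}_{C}(x)=\{v\in C\cap\operatorname{int}\operatorname{dom} f:\ (\forall c\in C)\ D_f(x,v)\le D_f(x,c)\}$. Writing $z=\overleftarrow{P}^{f}_{C}(y)$ (or $z=\overrightarrow{P}^{f}_{C}(y)$) means that the set equals $\{z\}$. A Legendre function $f$ with $\operatorname{dom} f^*$ open allows forward Bregman projections if: $\nabla^2 f$ exists and is continuous on $\operatorname{int}\operatorname{dom} f$; $D_f$ is convex on $(\operatorname{int}\operatorname{dom} f)^2$; and for every $x\in\operatorname{int}\operatorname{dom} f$, $D_f(x,\cdot)$ is strictly convex on $\operatorname{int}\operatorname{dom} f$. $D_{D_f}$ is the Bregman distance associated with the function $D_f$ on $\mathcal{H}\times\mathcal{H}$: for $y,z\in\operatorname{int}\operatorname{dom} f$, $D_{D_f}((u,u),(y,z))=D_f(u,u)-D_f(y,z)-\big\langle\big(\nabla f(y)-\nabla f(z),\,-\nabla^2 f(z)(y-z)\big),(u-y,u-z)\big\rangle$.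
   Formalization: In (iii)(c), u ranges only over points of U not in dom f \ int dom f: at such a point D_f(u,u)=+∞ while D_f(u,y) is finite, so the identity fails there (e.g. f(x)=x ln x − x, U=R, y=z=1, u=0). *)

theory Defs
  imports "HOL-Analysis.Analysis"
begin

text \<open>Functions into \<open>]-\<infinity>,+\<infinity>]\<close> are encoded as \<^typ>\<open>ereal\<close>-valued functions; properness in
  \<open>Gamma0\<close> excludes the value \<open>-\<infinity>\<close>.\<close>

definition edom :: "('a \<Rightarrow> ereal) \<Rightarrow> 'a set"
  where "edom f = {x. f x < \<infinity>}"

definition epi :: "('a \<Rightarrow> ereal) \<Rightarrow> ('a \<times> real) set"
  where "epi f = {(x, r). f x \<le> ereal r}"

definition Gamma0 :: "('a::real_inner \<Rightarrow> ereal) set"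
  where "Gamma0 = {f. (\<forall>x. f x \<noteq> -\<infinity>) \<and> edom f \<noteq> {} \<and> closed (epi f) \<and> convex (epi f)}"

definition fenchel_conj :: "('a::real_inner \<Rightarrow> ereal) \<Rightarrow> 'a \<Rightarrow> ereal"
  where "fenchel_conj f u = (SUP x. ereal (x \<bullet> u) - f x)"

definition subdiff :: "('a::real_inner \<Rightarrow> ereal) \<Rightarrow> 'a \<Rightarrow> 'a set"
  where "subdiff f x = {u. \<forall>y. f x + ereal ((y - x) \<bullet> u) \<le> f y}"

definition dom_subdiff :: "('a::real_inner \<Rightarrow> ereal) \<Rightarrow> 'a set"
  where "dom_subdiff f = {x. subdiff f x \<noteq> {}}"

definition subdiff_inv :: "('a::real_inner \<Rightarrow> ereal) \<Rightarrow> 'a \<Rightarrow> 'a set"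
  where "subdiff_inv f u = {x. u \<in> subdiff f x}"

definition strictly_convex_on :: "'a::real_vector set \<Rightarrow> ('a \<Rightarrow> ereal) \<Rightarrow> bool"
  where "strictly_convex_on S f \<longleftrightarrow> convex S \<and>
    (\<forall>x\<in>S. \<forall>y\<in>S. \<forall>t::real. x \<noteq> y \<and> 0 < t \<and> t < 1 \<longrightarrow>
       f ((1 - t) *\<^sub>R x + t *\<^sub>R y) < ereal (1 - t) * f x + ereal t * f y)"

text \<open>Gateaux differentiability, with the derivative represented by a vector. Around an interior
  point of the domain a proper function is finite along every line, so that
  \<^const>\<open>real_of_ereal\<close> loses nothing in the difference quotient.\<close>

definition has_gateaux_gradient :: "('a::real_inner \<Rightarrow> ereal) \<Rightarrow> 'a \<Rightarrow> 'a \<Rightarrow> bool"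
  where "has_gateaux_gradient f x v \<longleftrightarrow> x \<in> interior (edom f) \<and>
    (\<forall>h. ((\<lambda>t. real_of_ereal (f (x + t *\<^sub>R h))) has_real_derivative v \<bullet> h) (at 0))"

definition gateaux_differentiable :: "('a::real_inner \<Rightarrow> ereal) \<Rightarrow> 'a \<Rightarrow> bool"
  where "gateaux_differentiable f x \<longleftrightarrow> (\<exists>v. has_gateaux_gradient f x v)"

definition grad :: "('a::real_inner \<Rightarrow> ereal) \<Rightarrow> 'a \<Rightarrow> 'a"
  where "grad f x = (THE v. has_gateaux_gradient f x v)"

definition hess :: "('a::real_inner \<Rightarrow> ereal) \<Rightarrow> 'a \<Rightarrow> 'a \<Rightarrow> 'a"
  where "hess f x = frechet_derivative (grad f) (at x)"

definition hess_exists_continuous_on :: "'a::real_inner set \<Rightarrow> ('a \<Rightarrow> ereal) \<Rightarrow> bool"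
  where "hess_exists_continuous_on S f \<longleftrightarrow>
    (\<forall>x\<in>S. gateaux_differentiable f x \<and> grad f differentiable (at x)) \<and>
    continuous_on S (\<lambda>x. Blinfun (hess f x))"

definition essentially_smooth :: "('a::real_inner \<Rightarrow> ereal) \<Rightarrow> bool"
  where "essentially_smooth f \<longleftrightarrow>
    dom_subdiff f = interior (edom f) \<and> interior (edom f) \<noteq> {} \<and>
    (\<forall>x\<in>interior (edom f). gateaux_differentiable f x) \<and>
    (\<forall>X p. (\<forall>k. X k \<in> interior (edom f)) \<and> X \<longlonglongrightarrow> p \<and> p \<in> frontier (edom f) \<longrightarrow>
       filterlim (\<lambda>k. norm (grad f (X k))) at_top sequentially)"

definition essentially_strictly_convex :: "('a::real_inner \<Rightarrow> ereal) \<Rightarrow> bool"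
  where "essentially_strictly_convex f \<longleftrightarrow>
    (\<forall>u. subdiff_inv f u \<noteq> {} \<longrightarrow> (\<exists>e>0. bounded (\<Union>v\<in>cball u e. subdiff_inv f v))) \<and>
    (\<forall>C. convex C \<and> C \<subseteq> dom_subdiff f \<longrightarrow> strictly_convex_on C f)"

definition legendre :: "('a::real_inner \<Rightarrow> ereal) \<Rightarrow> bool"
  where "legendre f \<longleftrightarrow> f \<in> Gamma0 \<and> essentially_smooth f \<and> essentially_strictly_convex f"

definition bregman :: "('a::real_inner \<Rightarrow> ereal) \<Rightarrow> 'a \<Rightarrow> 'a \<Rightarrow> ereal"
  where "bregman f x y =
    (if y \<in> interior (edom f) then f x - f y - ereal (grad f y \<bullet> (x - y)) else \<infinity>)"

text \<open>\<open>bregman2 f\<close> is the Bregman distance of the function \<open>D\<^sub>f\<close> on the product space. By the chain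
  rule and symmetry of the Hessian, the gradient of \<open>D\<^sub>f\<close> at an interior pair \<open>(y, z)\<close> is
  \<open>(grad f y - grad f z, - hess f z (y - z))\<close> when \<open>f\<close> is twice continuously differentiable.
  Note that \<open>bregman f u u = \<infinity>\<close>, hence also \<open>bregman2 f (u, u) (y, z) = \<infinity>\<close>, for \<open>u\<close> outside
  \<open>interior (edom f)\<close>, even if \<open>u \<in> edom f\<close>.\<close>

definition bregman2 :: "('a::real_inner \<Rightarrow> ereal) \<Rightarrow> 'a \<times> 'a \<Rightarrow> 'a \<times> 'a \<Rightarrow> ereal"
  where "bregman2 f = bregman (\<lambda>(x, y). bregman f x y)"

definition bproj :: "('a::real_inner \<Rightarrow> ereal) \<Rightarrow> 'a set \<Rightarrow> 'a \<Rightarrow> 'a set"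
  where "bproj f C y = {u \<in> C \<inter> edom f. \<forall>c\<in>C. bregman f u y \<le> bregman f c y}"

definition fproj :: "('a::real_inner \<Rightarrow> ereal) \<Rightarrow> 'a set \<Rightarrow> 'a \<Rightarrow> 'a set"
  where "fproj f C x = {v \<in> C \<inter> interior (edom f). \<forall>c\<in>C. bregman f x v \<le> bregman f x c}"

text \<open>\<open>D\<^sub>f\<close> is finite on pairs of interior points, so convexity there can be stated with
  \<^const>\<open>convex_on\<close> after \<^const>\<open>real_of_ereal\<close>.\<close>

definition allows_forward_proj :: "('a::real_inner \<Rightarrow> ereal) \<Rightarrow> bool"
  where "allows_forward_proj f \<longleftrightarrow>
    legendre f \<and> open (edom (fenchel_conj f)) \<and>
    hess_exists_continuous_on (interior (edom f)) f \<and>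
    convex_on (interior (edom f) \<times> interior (edom f)) (\<lambda>(x, y). real_of_ereal (bregman f x y)) \<and>
    (\<forall>x\<in>interior (edom f). strictly_convex_on (interior (edom f)) (bregman f x))"

end

theory Submission
  imports Defs
begin

text \<open>
  Everything reduces to first-order optimality along the lines of the affine subspace. The one
  delicate point is that a backward projection \<open>z\<close> lies in the interior of the domain. Otherwise,
  let \<open>x\<close> tend to \<open>z\<close> along the segment from an interior point \<open>u0\<close> of \<open>U\<close>. Minimality of \<open>z\<close>
  bounds \<open>\<langle>\<nabla>f(x), u0 - z\<rangle>\<close> from below, and an upper bound of \<open>f\<close> on a ball around \<open>u0\<close> (which
  exists by Baire's theorem) then bounds \<open>\<parallel>\<nabla>f(x)\<parallel>\<close>, against essential smoothness.

  For forward projections, symmetry of the Hessian shows that the derivative of \<open>D\<^sub>f(y, _)\<close> at \<open>z\<close>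
  in direction \<open>h\<close> is \<open>- \<langle>h, \<nabla>\<^sup>2f(z)(y - z)\<rangle>\<close>, and joint convexity makes stationarity sufficient.
\<close>

section \<open>Convex extended-real-valued functions and their domains\<close>

lemma edom_real_of_ereal:
  assumes "f \<in> Gamma0" "x \<in> edom f"
  shows "f x = ereal (real_of_ereal (f x))"
proof -
  have "f x \<noteq> \<infinity>" "f x \<noteq> -\<infinity>"
    using assms by (auto simp: edom_def Gamma0_def)
  then show ?thesis
    by (cases "f x") auto
qed

lemma not_edom: "x \<notin> edom f \<longleftrightarrow> f x = \<infinity>"
  by (simp add: edom_def)

lemma interior_edom: "x \<in> interior (edom f) \<Longrightarrow> x \<in> edom f"
  using interior_subset by blast

text \<open>The points \<open>(x, real_of_ereal (f x))\<close> with \<open>x\<close> in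
  \<open>edom f\<close> lie in the epigraph, so its convexity yields both the convexity of the
  domain and the inequality, now over the reals.\<close>

lemma Gamma0_convex_on:
  assumes "f \<in> Gamma0"
  shows "convex_on (edom f) (\<lambda>x. real_of_ereal (f x))"
proof -
  have c: "convex (epi f)"
    using assms by (simp add: Gamma0_def)
  have *: "f (u *\<^sub>R x + v *\<^sub>R y) \<le> ereal (u * real_of_ereal (f x) + v * real_of_ereal (f y))"
    if "x \<in> edom f" "y \<in> edom f" "0 \<le> u" "0 \<le> v" "u + v = 1" for x y u v
  proof -
    have "(x, real_of_ereal (f x)) \<in> epi f" "(y, real_of_ereal (f y)) \<in> epi f"
      using edom_real_of_ereal[OF assms] that by (auto simp: epi_def)
    from convexD[OF c this that(3-5)] show ?thesis
      by (simp add: epi_def)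
  qed
  have dom: "u *\<^sub>R x + v *\<^sub>R y \<in> edom f"
    if "x \<in> edom f" "y \<in> edom f" "0 \<le> u" "0 \<le> v" "u + v = 1" for x y u v
    using *[OF that] by (auto simp: edom_def)
  show ?thesis
    unfolding convex_on_def convex_def
  proof (intro conjI ballI allI impI)
    fix x y and u v :: real
    assume a: "x \<in> edom f" "y \<in> edom f" "0 \<le> u" "0 \<le> v" "u + v = 1"
    show "u *\<^sub>R x + v *\<^sub>R y \<in> edom f"
      using dom[OF a] .
    show "real_of_ereal (f (u *\<^sub>R x + v *\<^sub>R y))
        \<le> u * real_of_ereal (f x) + v * real_of_ereal (f y)"
      using *[OF a] edom_real_of_ereal[OF assms dom[OF a]] by (metis ereal_less_eq(3))
  qed
qed

lemma convex_edom: "f \<in> Gamma0 \<Longrightarrow> convex (edom f)"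
  using Gamma0_convex_on convex_on_imp_convex by blast

lemma Gamma0_closed_sublevel:
  assumes "f \<in> Gamma0"
  shows "closed {x. f x \<le> ereal r}"
proof -
  have "closed (epi f)"
    using assms by (simp add: Gamma0_def)
  then have "closed ((\<lambda>x. (x, r)) -` epi f)"
    by (intro continuous_closed_vimage continuous_intros)
  then show ?thesis
    by (simp add: epi_def vimage_def)
qed

section \<open>Interior points of convex sets and a local upper bound\<close>

lemma convex_shrink_ball:
  fixes x c :: "'a::real_normed_vector"
  assumes "0 < t" "y \<in> ball (x + t *\<^sub>R (c - x)) (t * d)"
  obtains w where "w \<in> ball c d" "y = (1 - t) *\<^sub>R x + t *\<^sub>R w"
proof
  \<comment> \<open>The homothety with centre \<open>x\<close> and ratio \<open>t\<close> maps
    \<open>ball c d\<close> onto the smaller ball; \<open>?w\<close> is the preimage of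
    \<open>y\<close>.\<close>
  let ?w = "x + (1 / t) *\<^sub>R (y - x)"
  have "c - ?w = (1 / t) *\<^sub>R (x + t *\<^sub>R (c - x) - y)"
    using assms(1) by (simp add: algebra_simps)
  then have "norm (c - ?w) = norm (x + t *\<^sub>R (c - x) - y) / t"
    using assms(1) by simp
  also have "\<dots> < d"
    using assms by (simp only: mem_ball dist_norm pos_divide_less_eq) (simp add: mult.commute)
  finally show "?w \<in> ball c d"
    by (simp add: dist_norm)
  show "y = (1 - t) *\<^sub>R x + t *\<^sub>R ?w"
    using assms(1) by (simp add: algebra_simps)
qed

text \<open>The homothety of \<open>convex_shrink_ball\<close> carries a ball around
  \<open>c\<close> to a ball around the new point, and convexity keeps it in \<open>S\<close>. The
  endpoint \<open>x\<close> may be a boundary point.\<close>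

lemma convex_segment_interior:
  fixes S :: "'a::real_normed_vector set"
  assumes "convex S" "c \<in> interior S" "x \<in> S" "0 < t" "t \<le> 1"
  shows "x + t *\<^sub>R (c - x) \<in> interior S"
proof -
  obtain d where d: "d > 0" "ball c d \<subseteq> S"
    using assms(2) by (auto simp: mem_interior)
  have "ball (x + t *\<^sub>R (c - x)) (t * d) \<subseteq> S"
  proof
    fix y assume "y \<in> ball (x + t *\<^sub>R (c - x)) (t * d)"
    then obtain w where "w \<in> ball c d" "y = (1 - t) *\<^sub>R x + t *\<^sub>R w"
      using convex_shrink_ball assms(4) by blast
    then show "y \<in> S"
      using d assms by (auto intro!: convexD_alt)
  qed
  moreover have "t * d > 0"
    using assms d by simp
  ultimately show ?thesis
    unfolding mem_interior by blast
qed

lemma open_line: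
  fixes S :: "'a::real_normed_vector set"
  assumes "open S" "z \<in> S"
  obtains \<delta> where "\<delta> > 0" "\<And>t. \<bar>t\<bar> < \<delta> \<Longrightarrow> z + t *\<^sub>R h \<in> S"
proof -
  obtain d where d: "d > 0" "ball z d \<subseteq> S"
    using assms open_contains_ball by blast
  \<comment> \<open>Adding 1 keeps the denominator positive when \<open>h = 0\<close>.\<close>
  have p: "norm h + 1 > 0"
    by (simp add: add_nonneg_pos)
  show thesis
  proof
    show "d / (norm h + 1) > 0"
      using d p by simp
    fix t :: real assume "\<bar>t\<bar> < d / (norm h + 1)"
    then have "\<bar>t\<bar> * (norm h + 1) < d"
      using p by (simp only: pos_less_divide_eq)
    moreover have "\<bar>t\<bar> * norm h \<le> \<bar>t\<bar> * (norm h + 1)"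
      by (intro mult_left_mono) auto
    ultimately show "z + t *\<^sub>R h \<in> S"
      using d by (intro subsetD[OF d(2)]) (simp add: dist_norm)
  qed
qed

text \<open>The integer sublevel sets are closed and cover \<open>edom f\<close>, which has nonempty
  interior, so by Baire's theorem one of them contains a ball, though possibly far from
  \<open>x\<close>.\<close>

lemma Gamma0_bounded_above_near_interior:
  fixes f :: "'a::{real_inner, complete_space} \<Rightarrow> ereal"
  assumes f: "f \<in> Gamma0" and x: "x \<in> interior (edom f)"
  obtains r M where "r > 0" "\<And>y. y \<in> ball x r \<Longrightarrow> f y \<le> ereal M"
proof -
  define T where "T = (\<lambda>n::nat. {y. f y \<le> ereal (real n)})"
  have "edom f \<subseteq> \<Union> (range T)"
  proof
    fix y assume "y \<in> edom f"
    moreover obtain n :: nat where "real_of_ereal (f y) \<le> real n"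
      using real_arch_simple by blast
    ultimately have "f y \<le> ereal (real n)"
      using edom_real_of_ereal[OF f] by (metis ereal_less_eq(3))
    then show "y \<in> \<Union> (range T)"
      by (auto simp: T_def)
  qed
  then have "interior (\<Union> (range T)) \<noteq> {}"
    using x interior_mono by blast
  have "\<exists>n. interior (T n) \<noteq> {}"
  proof (rule ccontr)
    assume "\<not> ?thesis"
    then have "Met_TC.mtopology interior_of \<Union> (range T) = {}"
      using Gamma0_closed_sublevel[OF f]
      by (intro Met_TC.metric_Baire_category_alt) (auto simp: complete_UNIV T_def)
    then show False
      using \<open>interior (\<Union> (range T)) \<noteq> {}\<close> by simp
  qed
  then obtain n p e where e: "e > 0" "ball p e \<subseteq> T n"
    by (metis ex_in_conv mem_interior)
  obtain d where d: "d > 0" "\<And>t. \<bar>t\<bar> < d \<Longrightarrow> x + t *\<^sub>R (x - p) \<in> interior (edom f)"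
    using open_line[OF open_interior x] by blast
  define s where "s = d / 2"
  have s: "s > 0"
    using d by (simp add: s_def)
  \<comment> \<open>\<open>x\<close> lies strictly between \<open>p\<close> and \<open>q\<close>, so the bound on a ball around \<open>p\<close> is carried to a
      ball around \<open>x\<close> by convexity.\<close>
  define q where "q = x + s *\<^sub>R (x - p)"
  have q: "q \<in> edom f"
    using d by (auto simp: q_def s_def intro: interior_edom)
  \<comment> \<open>The solution of \<open>t * (1 + s) = s\<close>, which makes
    \<open>x = q + t *\<^sub>R (p - q)\<close>.\<close>
  define t where "t = s / (1 + s)"
  have t: "0 < t" "t \<le> 1"
    using s by (auto simp: t_def)
  have xt: "x = q + t *\<^sub>R (p - q)"
  proof -
    have "q + t *\<^sub>R (p - q) = x + (s - t * (1 + s)) *\<^sub>R (x - p)"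
      by (simp add: q_def algebra_simps)
    then show ?thesis
      using s by (simp add: t_def)
  qed
  define M where "M = max (real_of_ereal (f q)) (real n)"
  show thesis
  proof
    show "t * e > 0"
      using t e by simp
    fix y assume "y \<in> ball x (t * e)"
    then obtain w where w: "w \<in> ball p e" "y = (1 - t) *\<^sub>R q + t *\<^sub>R w"
      using convex_shrink_ball[OF t(1), of y q p e] xt by metis
    then have fw: "f w \<le> ereal (real n)"
      using e by (auto simp: T_def)
    then have wd: "w \<in> edom f"
      by (auto simp: edom_def)
    have "real_of_ereal (f w) \<le> real n"
      using fw edom_real_of_ereal[OF f wd] by (metis ereal_less_eq(3))
    moreover have "real_of_ereal (f y) \<le> (1 - t) * real_of_ereal (f q) + t * real_of_ereal (f w)"
      using convex_onD[OF Gamma0_convex_on[OF f], of t q w] t q wd w by simp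
    moreover have "\<dots> \<le> (1 - t) * M + t * M"
      using t calculation(1) by (intro add_mono mult_left_mono) (auto simp: M_def)
    ultimately have "real_of_ereal (f y) \<le> M"
      by (simp add: algebra_simps)
    moreover have "y \<in> edom f"
      using w q wd t convex_edom[OF f] by (auto intro!: convexD_alt)
    ultimately show "f y \<le> ereal M"
      using edom_real_of_ereal[OF f] by (metis ereal_less_eq(3))
  qed
qed

section \<open>Gateaux gradients and interiority of minimisers\<close>

lemma has_gateaux_gradient_unique:
  assumes "has_gateaux_gradient f x v" "has_gateaux_gradient f x w"
  shows "v = w"
proof -
  have "v \<bullet> h = w \<bullet> h" for h
    using assms DERIV_unique unfolding has_gateaux_gradient_def by blast
  then show ?thesis
    by (metis vector_eq_rdot)
qed

lemma grad_eqI: "has_gateaux_gradient f x v \<Longrightarrow> grad f x = v"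
  unfolding grad_def using has_gateaux_gradient_unique by blast

lemma has_gateaux_gradient_grad:
  "gateaux_differentiable f x \<Longrightarrow> has_gateaux_gradient f x (grad f x)"
  unfolding gateaux_differentiable_def using grad_eqI by metis

text \<open>Convexity bounds each difference quotient with \<open>0 < t < 1\<close> by the one at
  \<open>t = 1\<close>, and the bound survives the limit from the right.\<close>

lemma convex_on_directional_derivative_le:
  fixes g :: "'a::real_vector \<Rightarrow> real"
  assumes g: "convex_on S g" and "x \<in> S" "u \<in> S"
    and d: "((\<lambda>t. g (x + t *\<^sub>R (u - x))) has_real_derivative d) (at 0)"
  shows "d \<le> g u - g x"
proof -
  have "((\<lambda>t. (g (x + t *\<^sub>R (u - x)) - g x) / t) \<longlongrightarrow> d) (at_right 0)"
    using d by (auto simp: has_field_derivative_iff intro: tendsto_mono[OF at_le])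
  moreover have "\<forall>\<^sub>F t in at_right 0. (g (x + t *\<^sub>R (u - x)) - g x) / t \<le> g u - g x"
  proof -
    have "(g (x + t *\<^sub>R (u - x)) - g x) / t \<le> g u - g x" if "0 < t" "t < 1" for t
    proof -
      have "g ((1 - t) *\<^sub>R x + t *\<^sub>R u) \<le> (1 - t) * g x + t * g u"
        using convex_onD[OF g, of t x u] that assms by simp
      moreover have "(1 - t) *\<^sub>R x + t *\<^sub>R u = x + t *\<^sub>R (u - x)"
        by (simp add: algebra_simps)
      ultimately show ?thesis
        using that by (simp add: field_simps)
    qed
    then show ?thesis
      using eventually_at_right_real[of 0 "1::real"] by (auto elim: eventually_mono)
  qed
  ultimately show ?thesis
    by (intro tendsto_upperbound) auto
qed

lemma Gamma0_gradient_ineq: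
  assumes "f \<in> Gamma0" "has_gateaux_gradient f x v" "u \<in> edom f"
  shows "real_of_ereal (f x) + v \<bullet> (u - x) \<le> real_of_ereal (f u)"
proof -
  have "v \<bullet> (u - x) \<le> real_of_ereal (f u) - real_of_ereal (f x)"
    using assms Gamma0_convex_on[OF assms(1)]
    by (intro convex_on_directional_derivative_le) (auto simp: has_gateaux_gradient_def interior_edom)
  then show ?thesis by simp
qed

text \<open>Used with \<open>v = grad f y\<close>: on \<open>edom f\<close> the function
  \<open>bregman f _ y\<close> differs from \<open>f\<close> minus the functional \<open>v\<close>
  only by a constant.\<close>

lemma essentially_smooth_minimiser_interior:
  fixes f :: "'a::{real_inner, complete_space} \<Rightarrow> ereal"
  assumes f: "f \<in> Gamma0" and es: "essentially_smooth f"
    and C: "convex C" and u0: "u0 \<in> C" "u0 \<in> interior (edom f)"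
    and z: "z \<in> C" "z \<in> edom f"
    and min: "\<And>u. u \<in> C \<Longrightarrow> u \<in> edom f \<Longrightarrow>
        real_of_ereal (f z) - v \<bullet> z \<le> real_of_ereal (f u) - v \<bullet> u"
  shows "z \<in> interior (edom f)"
proof (rule ccontr)
  assume nz: "z \<notin> interior (edom f)"
  then have fr: "z \<in> frontier (edom f)"
    using z(2) closure_subset by (auto simp: frontier_def)
  \<comment> \<open>\<open>Suc k\<close> keeps every \<open>t k\<close> in ]0,1], so the whole
    sequence \<open>X\<close>, starting at \<open>X 0 = u0\<close>, is interior, as essential
    smoothness demands.\<close>
  define t where "t = (\<lambda>k::nat. inverse (real (Suc k)))"
  define X where "X = (\<lambda>k. z + t k *\<^sub>R (u0 - z))"
  have t: "0 < t k" "t k \<le> 1" for k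
    by (auto simp: t_def field_simps)
  have Xi: "X k \<in> interior (edom f)" for k
    unfolding X_def using convex_segment_interior[OF convex_edom[OF f] u0(2) z(2)] t by blast
  have XC: "X k \<in> C" for k
  proof -
    have "X k = (1 - t k) *\<^sub>R z + t k *\<^sub>R u0"
      by (simp add: X_def algebra_simps)
    then show ?thesis
      using convexD_alt[OF C z(1) u0(1), of "t k"] t[of k] by simp
  qed
  have tl: "t \<longlonglongrightarrow> 0"
    unfolding t_def by (rule LIMSEQ_inverse_real_of_nat)
  have "X \<longlonglongrightarrow> z + 0 *\<^sub>R (u0 - z)"
    unfolding X_def by (intro tendsto_intros tl)
  then have X: "X \<longlonglongrightarrow> z" by simp
  have lim: "filterlim (\<lambda>k. norm (grad f (X k))) at_top sequentially"
    using es Xi X fr unfolding essentially_smooth_def by blast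
  obtain r M where r: "r > 0" "\<And>y. y \<in> ball u0 r \<Longrightarrow> f y \<le> ereal M"
    using Gamma0_bounded_above_near_interior[OF f u0(2)] by blast
  define m where "m = real_of_ereal (f z)"
  \<comment> \<open>A bound independent of \<open>k\<close>: by Cauchy-Schwarz it dominates
    \<open>M - m - v \<bullet> (u0 - z)\<close>.\<close>
  define K where "K = M - m + norm v * norm (u0 - z) + norm v * norm (u0 - z)"
  \<comment> \<open>Evaluate the gradient inequality at \<open>X k\<close> in the point of the ball around \<open>u0\<close> that lies in
      the direction of the gradient.\<close>
  have K: "r / 2 * norm (grad f (X k)) \<le> K" for k
  proof -
    define G where "G = grad f (X k)"
    have G: "has_gateaux_gradient f (X k) G"
      unfolding G_def using es Xi[of k] has_gateaux_gradient_grad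
      unfolding essentially_smooth_def by blast
    define y where "y = u0 + (r / 2) *\<^sub>R sgn G"
    have "norm ((r / 2) *\<^sub>R sgn G) < r"
      using r(1) by (simp add: norm_sgn)
    then have "y \<in> ball u0 r"
      by (simp add: y_def dist_norm)
    then have fy: "f y \<le> ereal M"
      by (rule r)
    then have yd: "y \<in> edom f"
      by (auto simp: edom_def)
    have fyM: "real_of_ereal (f y) \<le> M"
      using fy edom_real_of_ereal[OF f yd] by (metis ereal_less_eq(3))
    have 1: "real_of_ereal (f (X k)) + G \<bullet> (y - X k) \<le> M"
      using Gamma0_gradient_ineq[OF f G yd] fyM by linarith
    have 2: "real_of_ereal (f (X k)) + G \<bullet> (z - X k) \<le> m"
      using Gamma0_gradient_ineq[OF f G z(2)] by (simp add: m_def)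
    have 3: "m + v \<bullet> (X k - z) \<le> real_of_ereal (f (X k))"
      using min[OF XC interior_edom[OF Xi], of k] by (simp add: m_def inner_diff_right)
    \<comment> \<open>Since \<open>X k - z\<close> is \<open>t k\<close> times
      \<open>u0 - z\<close>, the gradient inequality bounds \<open>f (X k) - f z\<close> from above
      and minimality bounds it from below; dividing by \<open>t k\<close> leaves a lower bound
      independent of \<open>k\<close>.\<close>
    have "t k * (v \<bullet> (u0 - z)) \<le> t k * (G \<bullet> (u0 - z))"
      using 2 3 by (simp add: X_def)
    then have 4: "v \<bullet> (u0 - z) \<le> G \<bullet> (u0 - z)"
      using t[of k] by simp
    have "y - X k = (1 - t k) *\<^sub>R (u0 - z) + (r / 2) *\<^sub>R sgn G"
      by (simp add: y_def X_def algebra_simps)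
    moreover have "G \<bullet> sgn G = norm G"
      by (cases "G = 0") (simp_all add: sgn_div_norm dot_square_norm power2_eq_square)
    ultimately have 5: "G \<bullet> (y - X k) = (1 - t k) * (G \<bullet> (u0 - z)) + r / 2 * norm G"
      by (simp add: inner_add_right)
    have "(1 - t k) * (v \<bullet> (u0 - z)) \<le> (1 - t k) * (G \<bullet> (u0 - z))"
      using 4 t[of k] by (intro mult_left_mono) auto
    moreover have "v \<bullet> (X k - z) = t k * (v \<bullet> (u0 - z))"
      by (simp add: X_def)
    \<comment> \<open>The weights \<open>1 - t k\<close> (from the gradient) and \<open>t k\<close>
      (from minimality) add up to one full \<open>v \<bullet> (u0 - z)\<close>.\<close>
    ultimately have "m + v \<bullet> (u0 - z) + r / 2 * norm G \<le> M"
      using 1 3 5 by (simp add: algebra_simps)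
    moreover have "- (v \<bullet> (u0 - z)) \<le> norm v * norm (u0 - z)"
      using Cauchy_Schwarz_ineq2[of v "u0 - z"] by linarith
    moreover have "0 \<le> norm v * norm (u0 - z)"
      by simp
    ultimately show ?thesis
      unfolding K_def G_def[symmetric] by linarith
  qed
  obtain k where "norm (grad f (X k)) > 2 * K / r"
    using lim unfolding filterlim_at_top_dense eventually_sequentially by blast
  then show False
    using K[of k] r(1) by (simp add: field_simps)
qed

section \<open>Symmetry of the second derivative\<close>

text \<open>The second difference is symmetric in \<open>a\<close> and \<open>b\<close>, while the mean value theorem along \<open>a\<close>
  gives a limit that is not visibly so; comparing the two orders yields symmetry of \<open>H\<close>.\<close>

lemma gateaux_second_difference:
  fixes g :: "'a::real_inner \<Rightarrow> real" and G :: "'a \<Rightarrow> 'a"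
  assumes S: "open S" "x \<in> S"
    and g: "\<And>y h. y \<in> S \<Longrightarrow> ((\<lambda>t. g (y + t *\<^sub>R h)) has_real_derivative G y \<bullet> h) (at 0)"
    and G: "(G has_derivative H) (at x)"
  shows "((\<lambda>t. (g (x + t *\<^sub>R a + t *\<^sub>R b) - g (x + t *\<^sub>R a) - g (x + t *\<^sub>R b) + g x) / t\<^sup>2)
           \<longlongrightarrow> H b \<bullet> a) (at_right 0)"
proof (rule tendstoI)
  fix e :: real assume e: "e > 0"
  interpret H: bounded_linear H
    using G has_derivative_bounded_linear by blast
  define N where "N = norm a + norm b + 1"
  have N: "N \<ge> 1" "norm a \<le> N" "norm b \<le> N" "norm a + norm b \<le> N"
    by (auto simp: N_def)
  \<comment> \<open>The factor 4 is for the end: two remainders of size \<open>e' * (t * N)\<close>,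
    paired with \<open>a\<close>, contribute at most \<open>t * (e / 2)\<close>.\<close>
  define e' where "e' = e / (4 * N * N)"
  have e': "e' > 0"
    using e N by (simp add: e'_def)
  obtain d1 where d1: "d1 > 0"
    "\<And>y. norm (y - x) < d1 \<Longrightarrow> norm (G y - G x - H (y - x)) \<le> e' * norm (y - x)"
    using G e' unfolding has_derivative_at_alt by blast
  obtain d2 where d2: "d2 > 0" "ball x d2 \<subseteq> S"
    using S open_contains_ball by blast
  \<comment> \<open>For \<open>t < d\<close> the parallelogram at \<open>x\<close> with sides
    \<open>t *\<^sub>R a\<close> and \<open>t *\<^sub>R b\<close> lies in \<open>S\<close> and where
    the first-order expansion of \<open>G\<close> is accurate.\<close>
  define d where "d = min d1 d2 / N"
  have "d > 0"
    using d1 d2 N by (simp add: d_def)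
  have main: "dist ((g (x + t *\<^sub>R a + t *\<^sub>R b) - g (x + t *\<^sub>R a) - g (x + t *\<^sub>R b) + g x) / t\<^sup>2) (H b \<bullet> a) < e"
    if t: "0 < t" "t < d" for t
  proof -
    have tN: "t * N < d1" "t * N < d2"
      using t N by (auto simp: d_def field_simps)
    have near: "norm (s *\<^sub>R a + q *\<^sub>R b) \<le> t * N" if "0 \<le> s" "s \<le> t" "0 \<le> q" "q \<le> t" for s q
    proof -
      have "norm (s *\<^sub>R a + q *\<^sub>R b) \<le> s * norm a + q * norm b"
        using norm_triangle_ineq[of "s *\<^sub>R a" "q *\<^sub>R b"] that by simp
      also have "\<dots> \<le> t * norm a + t * norm b"
        using that by (intro add_mono mult_right_mono) auto
      also have "\<dots> \<le> t * N"
        using t N(4) by (metis distrib_left less_eq_real_def mult_left_mono)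
      finally show ?thesis .
    qed
    have inS: "x + (s *\<^sub>R a + q *\<^sub>R b) \<in> S" if "0 \<le> s" "s \<le> t" "0 \<le> q" "q \<le> t" for s q
    proof -
      have "norm (s *\<^sub>R a + q *\<^sub>R b) < d2"
        using near[OF that] tN by linarith
      then have "x + (s *\<^sub>R a + q *\<^sub>R b) \<in> ball x d2"
        unfolding mem_ball dist_norm by (simp add: norm_minus_commute flip: norm_minus_cancel[of "s *\<^sub>R a + q *\<^sub>R b"])
      then show ?thesis using d2 by blast
    qed
    have err: "norm (G (x + (s *\<^sub>R a + q *\<^sub>R b)) - G x - H (s *\<^sub>R a + q *\<^sub>R b)) \<le> e' * (t * N)"
      if "0 \<le> s" "s \<le> t" "0 \<le> q" "q \<le> t" for s q
    proof -
      have "norm (G (x + (s *\<^sub>R a + q *\<^sub>R b)) - G x - H (s *\<^sub>R a + q *\<^sub>R b))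
          \<le> e' * norm (s *\<^sub>R a + q *\<^sub>R b)"
        using d1(2)[of "x + (s *\<^sub>R a + q *\<^sub>R b)"] near[OF that] tN by simp
      also have "\<dots> \<le> e' * (t * N)"
        using near[OF that] e' by simp
      finally show ?thesis .
    qed
    have der: "((\<lambda>s. g (x + (s *\<^sub>R a + q *\<^sub>R b))) has_real_derivative G (x + (s *\<^sub>R a + q *\<^sub>R b)) \<bullet> a) (at s)"
      if "0 \<le> s" "s \<le> t" "0 \<le> q" "q \<le> t" for s q
    proof -
      \<comment> \<open>Derivatives of \<open>g\<close> are given only at parameter 0 of a line
        through the current point; a shift by \<open>s\<close> turns this into a derivative at
        \<open>s\<close>.\<close>
      have "((\<lambda>r. g (x + (s *\<^sub>R a + q *\<^sub>R b) + r *\<^sub>R a)) has_real_derivative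
          G (x + (s *\<^sub>R a + q *\<^sub>R b)) \<bullet> a) (at (s - s))"
        using g[OF inS[OF that], of a] by simp
      then have "((\<lambda>r. g (x + (s *\<^sub>R a + q *\<^sub>R b) + (r - s) *\<^sub>R a)) has_real_derivative
          G (x + (s *\<^sub>R a + q *\<^sub>R b)) \<bullet> a) (at s)"
        using DERIV_shift[of "\<lambda>r. g (x + (s *\<^sub>R a + q *\<^sub>R b) + r *\<^sub>R a)" _ s "-s"] by simp
      moreover have "x + (s *\<^sub>R a + q *\<^sub>R b) + (r - s) *\<^sub>R a = x + (r *\<^sub>R a + q *\<^sub>R b)" for r
        by (simp add: algebra_simps)
      ultimately show ?thesis by simp
    qed
    \<comment> \<open>The increment of \<open>g\<close> along \<open>t *\<^sub>R b\<close> as a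
      function of the step along \<open>a\<close>, so that \<open>\<phi> t - \<phi> 0\<close> is the
      second difference. Writing \<open>0 *\<^sub>R b\<close> lets \<open>der\<close> and
      \<open>err\<close> apply with \<open>q = 0\<close>.\<close>
    define \<phi> where "\<phi> = (\<lambda>s. g (x + (s *\<^sub>R a + t *\<^sub>R b)) - g (x + (s *\<^sub>R a + 0 *\<^sub>R b)))"
    have "\<exists>s. 0 < s \<and> s < t \<and> \<phi> t - \<phi> 0 = (t - 0) *
        (G (x + (s *\<^sub>R a + t *\<^sub>R b)) \<bullet> a - G (x + (s *\<^sub>R a + 0 *\<^sub>R b)) \<bullet> a)"
      unfolding \<phi>_def using t by (intro MVT2 DERIV_diff der) auto
    then obtain s where s: "0 < s" "s < t" "\<phi> t - \<phi> 0 = t *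
        (G (x + (s *\<^sub>R a + t *\<^sub>R b)) \<bullet> a - G (x + (s *\<^sub>R a + 0 *\<^sub>R b)) \<bullet> a)"
      by auto
    \<comment> \<open>The difference of two first-order remainders: the parts
      \<open>H (s *\<^sub>R a)\<close> cancel, so the increment of \<open>G\<close> is
      \<open>t *\<^sub>R H b + E\<close>.\<close>
    define E where "E = (G (x + (s *\<^sub>R a + t *\<^sub>R b)) - G x - H (s *\<^sub>R a + t *\<^sub>R b))
       - (G (x + (s *\<^sub>R a + 0 *\<^sub>R b)) - G x - H (s *\<^sub>R a + 0 *\<^sub>R b))"
    have "norm E \<le> e' * (t * N) + e' * (t * N)"
      unfolding E_def using s t by (intro norm_triangle_le_diff add_mono err) auto
    moreover have "\<bar>E \<bullet> a\<bar> \<le> norm E * norm a"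
      by (rule Cauchy_Schwarz_ineq2)
    moreover have "norm E * norm a \<le> norm E * N"
      using N by (intro mult_left_mono) auto
    moreover have "norm E * N \<le> (e' * (t * N) + e' * (t * N)) * N"
      using calculation(1) N by (intro mult_right_mono) auto
    ultimately have Ea: "\<bar>E \<bullet> a\<bar> \<le> (e' * (t * N) + e' * (t * N)) * N"
      by linarith
    have "(e' * (t * N) + e' * (t * N)) * N = t * (e / 2)"
      using N by (simp add: e'_def field_simps)
    with Ea have Ea: "\<bar>E \<bullet> a\<bar> \<le> t * (e / 2)" by linarith
    have "G (x + (s *\<^sub>R a + t *\<^sub>R b)) - G (x + (s *\<^sub>R a + 0 *\<^sub>R b)) = t *\<^sub>R H b + E"
      by (simp add: E_def H.add H.scaleR)
    then have "\<phi> t - \<phi> 0 = t * ((t *\<^sub>R H b + E) \<bullet> a)"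
      using s(3) by (metis inner_diff_left)
    then have "\<phi> t - \<phi> 0 = t\<^sup>2 * (H b \<bullet> a) + t * (E \<bullet> a)"
      by (simp add: inner_add_left algebra_simps power2_eq_square)
    moreover have "\<phi> t - \<phi> 0 = g (x + t *\<^sub>R a + t *\<^sub>R b) - g (x + t *\<^sub>R a) - g (x + t *\<^sub>R b) + g x"
      by (simp add: \<phi>_def add.assoc)
    ultimately have "(g (x + t *\<^sub>R a + t *\<^sub>R b) - g (x + t *\<^sub>R a) - g (x + t *\<^sub>R b) + g x) / t\<^sup>2 - H b \<bullet> a
        = (E \<bullet> a) / t"
      using t by (simp add: field_simps power2_eq_square)
    moreover have "\<bar>(E \<bullet> a) / t\<bar> \<le> e / 2"
      using Ea t by (simp add: field_simps)
    ultimately show ?thesis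
      using e unfolding dist_real_def by linarith
  qed
  show "\<forall>\<^sub>F t in at_right 0. dist ((g (x + t *\<^sub>R a + t *\<^sub>R b) - g (x + t *\<^sub>R a) - g (x + t *\<^sub>R b) + g x) / t\<^sup>2) (H b \<bullet> a) < e"
    using eventually_at_right_real[OF \<open>d > 0\<close>] by (rule eventually_mono) (use main in auto)
qed

lemma gateaux_second_derivative_symmetric:
  fixes g :: "'a::real_inner \<Rightarrow> real" and G :: "'a \<Rightarrow> 'a"
  assumes S: "open S" "x \<in> S"
    and g: "\<And>y h. y \<in> S \<Longrightarrow> ((\<lambda>t. g (y + t *\<^sub>R h)) has_real_derivative G y \<bullet> h) (at 0)"
    and G: "(G has_derivative H) (at x)"
  shows "H a \<bullet> b = H b \<bullet> a"
proof -
  have "g (x + t *\<^sub>R b + t *\<^sub>R a) - g (x + t *\<^sub>R b) - g (x + t *\<^sub>R a) + g x =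
      g (x + t *\<^sub>R a + t *\<^sub>R b) - g (x + t *\<^sub>R a) - g (x + t *\<^sub>R b) + g x" for t
    by (simp add: add.assoc add.commute[of "t *\<^sub>R b"])
  with gateaux_second_difference[OF S g G, of b a]
  have "((\<lambda>t. (g (x + t *\<^sub>R a + t *\<^sub>R b) - g (x + t *\<^sub>R a) - g (x + t *\<^sub>R b) + g x) / t\<^sup>2)
           \<longlongrightarrow> H a \<bullet> b) (at_right 0)"
    by simp
  then show ?thesis
    using gateaux_second_difference[OF S g G, of a b]
    by (rule tendsto_unique[OF trivial_limit_at_right_real])
qed

section \<open>Bregman distances: finiteness, strict convexity and the three-point identity\<close>

lemma bregman_ereal:
  assumes "f \<in> Gamma0" "x \<in> edom f" "y \<in> interior (edom f)"
  shows "bregman f x y =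
    ereal (real_of_ereal (f x) - real_of_ereal (f y) - grad f y \<bullet> (x - y))"
  using edom_real_of_ereal[OF assms(1,2)] edom_real_of_ereal[OF assms(1) interior_edom[OF assms(3)]]
    assms(3) unfolding bregman_def by (metis ereal_minus(1))

lemma bregman_eq_infinity:
  assumes "f \<in> Gamma0" "x \<notin> edom f \<or> y \<notin> interior (edom f)"
  shows "bregman f x y = \<infinity>"
  using assms edom_real_of_ereal[OF assms(1) interior_edom, of y]
  by (cases "f y") (auto simp: bregman_def not_edom)

text \<open>\<open>bregman2\<close> asks whether a pair is interior to this domain; the product form
  lets \<open>interior_Times\<close> decide it.\<close>

lemma edom_bregman:
  assumes "f \<in> Gamma0"
  shows "edom (\<lambda>(x, y). bregman f x y) = edom f \<times> interior (edom f)"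
proof -
  have "bregman f x y < \<infinity> \<longleftrightarrow> x \<in> edom f \<and> y \<in> interior (edom f)" for x y
    using bregman_ereal[OF assms, of x y] bregman_eq_infinity[OF assms, of x y] by auto
  then show ?thesis
    by (auto simp: edom_def[of "\<lambda>(x, y). bregman f x y"])
qed

lemma legendre_gradient:
  assumes "legendre f" "x \<in> interior (edom f)"
  shows "has_gateaux_gradient f x (grad f x)"
  using assms has_gateaux_gradient_grad by (auto simp: legendre_def essentially_smooth_def)

text \<open>Essential smoothness identifies the interior with \<open>dom_subdiff f\<close>; being
  convex, it is itself one of the sets covered by essential strict convexity.\<close>

lemma legendre_strictly_convex_on_interior:
  assumes "legendre f"
  shows "strictly_convex_on (interior (edom f)) f"
proof -
  have "convex (interior (edom f))" "dom_subdiff f = interior (edom f)"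
    using assms convex_edom convex_interior by (auto simp: legendre_def essentially_smooth_def)
  then show ?thesis
    using assms by (auto simp: legendre_def essentially_strictly_convex_def)
qed

text \<open>Serves uniqueness: the midpoint of two distinct minimisers would do strictly
  better.\<close>

lemma strictly_convex_on_midpoint:
  assumes "strictly_convex_on S f" "x \<in> S" "y \<in> S" "x \<noteq> y"
    and "f x = ereal a" "f y = ereal b" "f (midpoint x y) = ereal c"
  shows "c < (a + b) / 2"
proof -
  have "f ((1 - t) *\<^sub>R x + t *\<^sub>R y) < ereal (1 - t) * f x + ereal t * f y"
    if "0 < t" "t < 1" for t :: real
    using assms(1-4) that unfolding strictly_convex_on_def by blast
  from this[of "1/2"]
  have "f ((1 - 1/2) *\<^sub>R x + (1/2::real) *\<^sub>R y) < ereal (1 - 1/2) * f x + ereal (1/2) * f y"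
    by simp
  moreover have "midpoint x y = (1 - 1/2) *\<^sub>R x + (1/2::real) *\<^sub>R y"
    by (simp add: midpoint_def scaleR_add_right)
  ultimately show ?thesis
    using assms(5-7) by (simp add: field_simps)
qed

lemma convex_midpoint_mem: "convex S \<Longrightarrow> x \<in> S \<Longrightarrow> y \<in> S \<Longrightarrow> midpoint x y \<in> S"
  using convexD[of S x y "1/2" "1/2"] by (simp add: midpoint_def scaleR_add_right)

text \<open>All terms are finite, and \<open>bregman f u y - bregman f u z - bregman f z y\<close>
  equals \<open>(grad f z - grad f y) \<bullet> (u - z)\<close>.\<close>

lemma bregman_three_point:
  assumes "f \<in> Gamma0" "u \<in> edom f" "z \<in> interior (edom f)" "y \<in> interior (edom f)"
  shows "bregman f u y = bregman f u z + bregman f z y \<longleftrightarrow> (grad f y - grad f z) \<bullet> (u - z) = 0"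
  using bregman_ereal[OF assms(1,2,4)] bregman_ereal[OF assms(1,2,3)]
    bregman_ereal[OF assms(1) interior_edom[OF assms(3)] assms(4)]
  by (simp add: inner_diff_left inner_diff_right algebra_simps) linarith

section \<open>Stationarity on affine sets and backward projections\<close>

lemma affine_line:
  assumes "affine U" "z \<in> U" "u \<in> U"
  shows "z + t *\<^sub>R (u - z) \<in> U"
proof -
  have "z + t *\<^sub>R (u - z) = (1 - t) *\<^sub>R z + t *\<^sub>R u"
    by (simp add: algebra_simps)
  then show ?thesis
    using mem_affine[OF assms, of "1 - t" t] by simp
qed

text \<open>The line through \<open>z\<close> and \<open>u\<close> stays in \<open>U\<close> and,
  near \<open>z\<close>, in \<open>S\<close> for both signs of \<open>t\<close>; Fermat's rule thus
  gives an equation where a general convex set gives only an inequality.\<close>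

lemma affine_minimiser_stationary:
  fixes \<psi> :: "'a::real_normed_vector \<Rightarrow> real"
  assumes "affine U" "open S" "z \<in> U \<inter> S" "u \<in> U"
    and min: "\<And>w. w \<in> U \<inter> S \<Longrightarrow> \<psi> z \<le> \<psi> w"
    and d: "((\<lambda>t. \<psi> (z + t *\<^sub>R (u - z))) has_real_derivative d) (at 0)"
  shows "d = 0"
proof -
  obtain \<delta> where \<delta>: "\<delta> > 0" "\<And>t. \<bar>t\<bar> < \<delta> \<Longrightarrow> z + t *\<^sub>R (u - z) \<in> S"
    using open_line assms by blast
  show ?thesis
  proof (rule DERIV_local_min[OF d \<delta>(1)], intro allI impI)
    fix t :: real assume "\<bar>0 - t\<bar> < \<delta>"
    then show "\<psi> (z + 0 *\<^sub>R (u - z)) \<le> \<psi> (z + t *\<^sub>R (u - z))"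
      using \<delta>(2)[of t] affine_line[of U z u t] assms by simp
  qed
qed

text \<open>Stated for any element of the projection set rather than for a singleton, so that the
  uniqueness proof can apply it to a competitor.\<close>

lemma bproj_memD:
  fixes f :: "'a::{real_inner, complete_space} \<Rightarrow> ereal"
  assumes f: "legendre f" and U: "affine U" "U \<inter> interior (edom f) \<noteq> {}"
    and y: "y \<in> interior (edom f)" and z: "z \<in> bproj f U y"
  shows "z \<in> U \<inter> interior (edom f)" "\<And>u. u \<in> U \<Longrightarrow> (grad f y - grad f z) \<bullet> (u - z) = 0"
proof -
  have G: "f \<in> Gamma0" and es: "essentially_smooth f"
    using f by (auto simp: legendre_def)
  have zU: "z \<in> U" "z \<in> edom f"
    using z by (auto simp: bproj_def)
  have min: "real_of_ereal (f z) - grad f y \<bullet> z \<le> real_of_ereal (f u) - grad f y \<bullet> u"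
    if "u \<in> U" "u \<in> edom f" for u
  proof -
    have "bregman f z y \<le> bregman f u y"
      using z that by (auto simp: bproj_def)
    then show ?thesis
      using bregman_ereal[OF G _ y] zU that by (simp add: inner_diff_right)
  qed
  obtain u0 where "u0 \<in> U" "u0 \<in> interior (edom f)"
    using U by auto
  then have zi: "z \<in> interior (edom f)"
    using essentially_smooth_minimiser_interior[OF G es affine_imp_convex[OF U(1)]] zU min by blast
  then show "z \<in> U \<inter> interior (edom f)"
    using zU by simp
  fix u assume u: "u \<in> U"
  let ?\<psi> = "\<lambda>w. real_of_ereal (f w) - grad f y \<bullet> w"
  have "((\<lambda>t. real_of_ereal (f (z + t *\<^sub>R (u - z)))) has_real_derivative grad f z \<bullet> (u - z)) (at 0)"
    using legendre_gradient[OF f zi] by (simp add: has_gateaux_gradient_def)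
  moreover have "((\<lambda>t. grad f y \<bullet> (z + t *\<^sub>R (u - z))) has_real_derivative grad f y \<bullet> (u - z)) (at 0)"
    by (auto simp: inner_add_right intro!: derivative_eq_intros)
  ultimately have "((\<lambda>t. ?\<psi> (z + t *\<^sub>R (u - z))) has_real_derivative
      grad f z \<bullet> (u - z) - grad f y \<bullet> (u - z)) (at 0)"
    by (rule DERIV_diff)
  then have "grad f z \<bullet> (u - z) - grad f y \<bullet> (u - z) = 0"
    using zU zi u min
    by (intro affine_minimiser_stationary[OF U(1) open_interior, where S1 = "edom f" and \<psi> = ?\<psi>])
       (auto simp: interior_edom)
  then show "(grad f y - grad f z) \<bullet> (u - z) = 0"
    by (simp add: inner_diff_left)
qed

lemma bproj_affine_iff:
  fixes f :: "'a::{real_inner, complete_space} \<Rightarrow> ereal"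
  assumes f: "legendre f" and U: "affine U" "U \<inter> interior (edom f) \<noteq> {}"
    and y: "y \<in> interior (edom f)"
  shows "bproj f U y = {z} \<longleftrightarrow>
    z \<in> U \<inter> interior (edom f) \<and> (\<forall>u\<in>U. (grad f y - grad f z) \<bullet> (u - z) = 0)"
proof
  assume "bproj f U y = {z}"
  then have "z \<in> bproj f U y" by simp
  then show "z \<in> U \<inter> interior (edom f) \<and> (\<forall>u\<in>U. (grad f y - grad f z) \<bullet> (u - z) = 0)"
    using bproj_memD[OF f U y] by blast
next
  assume z: "z \<in> U \<inter> interior (edom f) \<and> (\<forall>u\<in>U. (grad f y - grad f z) \<bullet> (u - z) = 0)"
  have G: "f \<in> Gamma0"
    using f by (auto simp: legendre_def)
  have zi: "z \<in> U" "z \<in> interior (edom f)" "z \<in> edom f"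
    using z interior_edom by auto
  have "bregman f z y \<le> bregman f u y" if "u \<in> U" for u
  proof (cases "u \<in> edom f")
    case True
    \<comment> \<open>Orthogonality replaces \<open>grad f z\<close> by \<open>grad f y\<close> in
      the gradient inequality at \<open>z\<close>, which then says that \<open>z\<close>
      minimises.\<close>
    have "(grad f y - grad f z) \<bullet> (u - z) = 0"
      using z that by blast
    then show ?thesis
      using Gamma0_gradient_ineq[OF G legendre_gradient[OF f zi(2)] True]
        bregman_ereal[OF G True y] bregman_ereal[OF G zi(3) y]
      by (simp add: inner_diff_left inner_diff_right)
  next
    case False
    then show ?thesis
      using bregman_eq_infinity[OF G] by simp
  qed
  then have zb: "z \<in> bproj f U y"
    using zi by (simp add: bproj_def)
  moreover have "u = z" if u: "u \<in> bproj f U y" for u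
  proof (rule ccontr)
    assume "u \<noteq> z"
    \<comment> \<open>Strict convexity is available on the interior, so the competitor is placed
      there first.\<close>
    have ui: "u \<in> U" "u \<in> interior (edom f)" "u \<in> edom f"
      using bproj_memD(1)[OF f U y u] interior_edom by auto
    have eq: "bregman f u y = bregman f z y"
      using u zb ui(1) zi(1) by (auto simp: bproj_def intro: antisym)
    have wU: "midpoint u z \<in> U"
      using convex_midpoint_mem affine_imp_convex[OF U(1)] ui(1) zi(1) by blast
    have wi: "midpoint u z \<in> interior (edom f)"
      using convex_midpoint_mem convex_interior[OF convex_edom[OF G]] ui(2) zi(2) by blast
    have "real_of_ereal (f (midpoint u z)) < (real_of_ereal (f u) + real_of_ereal (f z)) / 2"
      using strictly_convex_on_midpoint[OF legendre_strictly_convex_on_interior[OF f] ui(2) zi(2) \<open>u \<noteq> z\<close>]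
        edom_real_of_ereal[OF G] ui(3) zi(3) interior_edom[OF wi] by blast
    moreover have "grad f y \<bullet> midpoint u z = (grad f y \<bullet> u + grad f y \<bullet> z) / 2"
      by (simp add: midpoint_def inner_add_right)
    moreover have "bregman f z y \<le> bregman f (midpoint u z) y"
      using zb wU by (simp add: bproj_def)
    ultimately show False
      using eq bregman_ereal[OF G ui(3) y] bregman_ereal[OF G zi(3) y]
        bregman_ereal[OF G interior_edom[OF wi] y]
      by (simp add: inner_diff_right field_simps)
  qed
  ultimately show "bproj f U y = {z}"
    by blast
qed

text \<open>Bregman identities carry information only at points of the domain, whereas orthogonality
  concerns all of \<open>U\<close>. Shrinking \<open>u - z\<close> reaches the open set
  \<open>S\<close>, and homogeneity scales back.\<close>

lemma homogeneous_vanishing_on_affine: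
  fixes S :: "'a::real_normed_vector set"
  assumes "affine U" "open S" "z \<in> U \<inter> S" "u \<in> U"
    and \<phi>: "\<And>c w. \<phi> (c *\<^sub>R w) = c * \<phi> w"
    and zero: "\<And>w. w \<in> U \<inter> S \<Longrightarrow> \<phi> (w - z) = (0::real)"
  shows "\<phi> (u - z) = 0"
proof -
  obtain \<delta> where \<delta>: "\<delta> > 0" "\<And>t. \<bar>t\<bar> < \<delta> \<Longrightarrow> z + t *\<^sub>R (u - z) \<in> S"
    using open_line assms by blast
  then have "z + (\<delta> / 2) *\<^sub>R (u - z) \<in> U \<inter> S"
    using affine_line[of U z u "\<delta> / 2"] assms by simp
  from zero[OF this] show ?thesis
    using \<delta>(1) by (simp add: \<phi>)
qed

lemma affine_three_point_iff:
  assumes f: "f \<in> Gamma0" and U: "affine U"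
    and y: "y \<in> interior (edom f)" and z: "z \<in> U \<inter> interior (edom f)"
  shows "(\<forall>u\<in>U. bregman f u y = bregman f u z + bregman f z y) \<longleftrightarrow>
    (\<forall>u\<in>U. (grad f y - grad f z) \<bullet> (u - z) = 0)"
proof
  assume a: "\<forall>u\<in>U. bregman f u y = bregman f u z + bregman f z y"
  show "\<forall>u\<in>U. (grad f y - grad f z) \<bullet> (u - z) = 0"
  proof
    fix u assume u: "u \<in> U"
    show "(grad f y - grad f z) \<bullet> (u - z) = 0"
    proof (rule homogeneous_vanishing_on_affine[OF U open_interior z u])
      fix w assume "w \<in> U \<inter> interior (edom f)"
      then show "(grad f y - grad f z) \<bullet> (w - z) = 0"
        using a bregman_three_point[OF f _ _ y] z interior_edom by blast
    qed simp
  qed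
next
  assume a: "\<forall>u\<in>U. (grad f y - grad f z) \<bullet> (u - z) = 0"
  show "\<forall>u\<in>U. bregman f u y = bregman f u z + bregman f z y"
  proof
    fix u assume u: "u \<in> U"
    show "bregman f u y = bregman f u z + bregman f z y"
    proof (cases "u \<in> edom f")
      case True
      then show ?thesis
        using a u bregman_three_point[OF f _ _ y] z by blast
    next
      case False
      \<comment> \<open>Outside the domain both sides are infinite, because
        \<open>bregman f z y\<close> is finite.\<close>
      then show ?thesis
        using bregman_eq_infinity[OF f] bregman_ereal[OF f interior_edom y, of z] z by simp
    qed
  qed
qed

lemma subspace_shift_annihilator:
  fixes L :: "'a::real_inner set"
  assumes "subspace L" "z \<in> L"
  shows "(\<forall>u\<in>L. (u - z) \<bullet> v = 0) \<longleftrightarrow> v \<in> L\<^sup>\<bottom>"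
proof
  assume a: "\<forall>u\<in>L. (u - z) \<bullet> v = 0"
  \<comment> \<open>As \<open>z\<close> lies in \<open>L\<close>, testing with \<open>u + z\<close>
    recovers an arbitrary \<open>u\<close>.\<close>
  have "u \<bullet> v = 0" if "u \<in> L" for u
    using a subspace_add[OF assms(1) that assms(2)] by force
  then show "v \<in> L\<^sup>\<bottom>"
    by (simp add: orthogonal_comp_def orthogonal_def)
next
  assume "v \<in> L\<^sup>\<bottom>"
  then show "\<forall>u\<in>L. (u - z) \<bullet> v = 0"
    using subspace_diff[OF assms(1) _ assms(2)] by (simp add: orthogonal_comp_def orthogonal_def)
qed

section \<open>Derivatives of the Bregman distance and forward projections\<close>

lemma hess_has_derivative:
  assumes "hess_exists_continuous_on (interior (edom f)) f" "z \<in> interior (edom f)"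
  shows "(grad f has_derivative hess f z) (at z)"
  using assms frechet_derivative_works
  by (auto simp: hess_exists_continuous_on_def hess_def)

lemma hess_symmetric:
  assumes h: "hess_exists_continuous_on (interior (edom f)) f" and z: "z \<in> interior (edom f)"
  shows "hess f z a \<bullet> b = hess f z b \<bullet> a"
proof (rule gateaux_second_derivative_symmetric[OF open_interior z _ hess_has_derivative[OF h z]])
  fix y h' assume "y \<in> interior (edom f)"
  then show "((\<lambda>t. real_of_ereal (f (y + t *\<^sub>R h'))) has_real_derivative grad f y \<bullet> h') (at 0)"
    using h has_gateaux_gradient_grad[of f y]
    by (auto simp: hess_exists_continuous_on_def has_gateaux_gradient_def)
qed

text \<open>General directions \<open>(a, b)\<close> give the gradient on the product space;
  \<open>a = 0\<close> gives the derivative in the second argument, used for forward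
  projections.\<close>

lemma bregman_directional_derivative:
  assumes G: "f \<in> Gamma0" and h: "hess_exists_continuous_on (interior (edom f)) f"
    and y: "y \<in> interior (edom f)" and z: "z \<in> interior (edom f)"
  shows "((\<lambda>t. real_of_ereal (bregman f (y + t *\<^sub>R a) (z + t *\<^sub>R b))) has_real_derivative
      (grad f y - grad f z) \<bullet> a + (- hess f z (y - z)) \<bullet> b) (at 0)"
proof -
  have gg: "((\<lambda>t. real_of_ereal (f (w + t *\<^sub>R c))) has_derivative (\<lambda>t. t * (grad f w \<bullet> c))) (at 0)"
    if "w \<in> interior (edom f)" for w c
    using that h has_gateaux_gradient_grad[of f w]
    by (auto simp: hess_exists_continuous_on_def has_gateaux_gradient_def has_field_derivative_def
        mult_commute_abs)
  interpret H: bounded_linear "hess f z"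
    using hess_has_derivative[OF h z] has_derivative_bounded_linear by blast
  have "((\<lambda>t::real. z + t *\<^sub>R b) has_derivative (\<lambda>t. t *\<^sub>R b)) (at 0)"
    by (auto intro!: derivative_eq_intros)
  then have "((\<lambda>t::real. grad f (z + t *\<^sub>R b)) has_derivative (\<lambda>t. hess f z (t *\<^sub>R b))) (at 0)"
    using has_derivative_compose[of "\<lambda>t::real. z + t *\<^sub>R b" _ 0 UNIV "grad f" "hess f z"]
      hess_has_derivative[OF h z] by simp
  moreover have "((\<lambda>t::real. (y + t *\<^sub>R a) - (z + t *\<^sub>R b)) has_derivative (\<lambda>t. t *\<^sub>R a - t *\<^sub>R b)) (at 0)"
    by (auto intro!: derivative_eq_intros)
  ultimately have inn: "((\<lambda>t::real. grad f (z + t *\<^sub>R b) \<bullet> ((y + t *\<^sub>R a) - (z + t *\<^sub>R b))) has_derivative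
      (\<lambda>t. grad f z \<bullet> (t *\<^sub>R a - t *\<^sub>R b) + hess f z (t *\<^sub>R b) \<bullet> (y - z))) (at 0)"
    by (rule has_derivative_inner[THEN has_derivative_eq_rhs]) simp
  have "((\<lambda>t. real_of_ereal (f (y + t *\<^sub>R a)) - real_of_ereal (f (z + t *\<^sub>R b))
        - grad f (z + t *\<^sub>R b) \<bullet> ((y + t *\<^sub>R a) - (z + t *\<^sub>R b))) has_derivative
      (\<lambda>t. t * (grad f y \<bullet> a) - t * (grad f z \<bullet> b)
        - (grad f z \<bullet> (t *\<^sub>R a - t *\<^sub>R b) + hess f z (t *\<^sub>R b) \<bullet> (y - z)))) (at 0)"
    by (intro has_derivative_diff gg y z inn)
  \<comment> \<open>The terms in \<open>grad f z \<bullet> b\<close> cancel, and symmetry moves the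
    Hessian from \<open>b\<close> to \<open>y - z\<close>.\<close>
  moreover have "(\<lambda>t. t * (grad f y \<bullet> a) - t * (grad f z \<bullet> b)
        - (grad f z \<bullet> (t *\<^sub>R a - t *\<^sub>R b) + hess f z (t *\<^sub>R b) \<bullet> (y - z)))
     = (*) ((grad f y - grad f z) \<bullet> a + (- hess f z (y - z)) \<bullet> b)"
    using hess_symmetric[OF h z, of b "y - z"]
    by (auto simp: fun_eq_iff H.scaleR inner_diff_left inner_diff_right algebra_simps)
  ultimately have D: "((\<lambda>t. real_of_ereal (f (y + t *\<^sub>R a)) - real_of_ereal (f (z + t *\<^sub>R b))
        - grad f (z + t *\<^sub>R b) \<bullet> ((y + t *\<^sub>R a) - (z + t *\<^sub>R b))) has_real_derivative
      (grad f y - grad f z) \<bullet> a + (- hess f z (y - z)) \<bullet> b) (at 0)"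
    by (simp add: has_field_derivative_def)
  \<comment> \<open>The real formula represents \<open>bregman\<close> as long as both arguments are
    interior, which holds for small \<open>t\<close>.\<close>
  obtain d1 where d1: "d1 > 0" "\<And>t. \<bar>t\<bar> < d1 \<Longrightarrow> y + t *\<^sub>R a \<in> interior (edom f)"
    using open_line[OF open_interior y] by blast
  obtain d2 where d2: "d2 > 0" "\<And>t. \<bar>t\<bar> < d2 \<Longrightarrow> z + t *\<^sub>R b \<in> interior (edom f)"
    using open_line[OF open_interior z] by blast
  show ?thesis
  proof (rule has_field_derivative_transform_within[OF D])
    show "0 < min d1 d2"
      using d1 d2 by simp
    fix t :: real assume "dist t 0 < min d1 d2"
    then have "y + t *\<^sub>R a \<in> interior (edom f)" "z + t *\<^sub>R b \<in> interior (edom f)"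
      using d1 d2 by auto
    then show "real_of_ereal (f (y + t *\<^sub>R a)) - real_of_ereal (f (z + t *\<^sub>R b))
        - grad f (z + t *\<^sub>R b) \<bullet> ((y + t *\<^sub>R a) - (z + t *\<^sub>R b))
        = real_of_ereal (bregman f (y + t *\<^sub>R a) (z + t *\<^sub>R b))"
      by (simp add: bregman_ereal[OF G interior_edom])
  qed simp
qed

text \<open>Evaluates the definite description \<open>grad\<close> on the product space, so that
  \<open>bregman2\<close> becomes an explicit formula.\<close>

lemma grad_bregman:
  assumes "f \<in> Gamma0" and "hess_exists_continuous_on (interior (edom f)) f"
    and "y \<in> interior (edom f)" and "z \<in> interior (edom f)"
  shows "grad (\<lambda>(x, y). bregman f x y) (y, z) = (grad f y - grad f z, - hess f z (y - z))"
  using bregman_directional_derivative[OF assms] assms(3,4)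
  by (intro grad_eqI) (auto simp: has_gateaux_gradient_def edom_bregman[OF assms(1)] interior_Times)

text \<open>The right-hand sum exceeds \<open>bregman f u y\<close> by exactly
  \<open>(u - z) \<bullet> hess f z (y - z)\<close>; for interior \<open>u\<close> the term
  \<open>bregman f u u\<close> is 0.\<close>

lemma bregman_bregman2:
  assumes G: "f \<in> Gamma0" and h: "hess_exists_continuous_on (interior (edom f)) f"
    and y: "y \<in> interior (edom f)" and z: "z \<in> interior (edom f)" and u: "u \<in> interior (edom f)"
  shows "bregman f u y = bregman f u z + bregman2 f (u, u) (y, z) \<longleftrightarrow>
    (u - z) \<bullet> hess f z (y - z) = 0"
proof -
  have i: "(y, z) \<in> interior (edom (\<lambda>(x, y). bregman f x y))"
    using y z by (simp add: edom_bregman[OF G] interior_Times)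
  have "bregman2 f (u, u) (y, z) = ereal (0 - (real_of_ereal (f y) - real_of_ereal (f z) - grad f z \<bullet> (y - z))
      - ((grad f y - grad f z) \<bullet> (u - y) - hess f z (y - z) \<bullet> (u - z)))"
    unfolding bregman2_def bregman_def[of "\<lambda>(x, y). bregman f x y"] grad_bregman[OF G h y z]
    using i bregman_ereal[OF G interior_edom[OF y] z] bregman_ereal[OF G interior_edom[OF u] u]
    by simp
  then show ?thesis
    using bregman_ereal[OF G interior_edom[OF u]] y z
    by (simp add: inner_diff_left inner_diff_right algebra_simps inner_commute) linarith
qed

text \<open>Elements of \<open>fproj\<close> are interior by definition, so the boundary argument of
  the backward case does not arise. Stationarity is necessary along lines and sufficient by
  convexity; strict convexity gives uniqueness.\<close>

lemma fproj_affine_iff: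
  assumes f: "allows_forward_proj f" and U: "affine U" and y: "y \<in> interior (edom f)"
  shows "fproj f U y = {z} \<longleftrightarrow>
    z \<in> U \<inter> interior (edom f) \<and> (\<forall>u\<in>U. (u - z) \<bullet> hess f z (y - z) = 0)"
proof -
  have G: "f \<in> Gamma0" and h: "hess_exists_continuous_on (interior (edom f)) f"
    and sc: "strictly_convex_on (interior (edom f)) (bregman f y)"
    using f y by (auto simp: allows_forward_proj_def legendre_def)
  let ?D = "\<lambda>w. real_of_ereal (bregman f y w)"
  have fin: "bregman f y w = ereal (?D w)" if "w \<in> interior (edom f)" for w
    using bregman_ereal[OF G interior_edom[OF y] that] by simp
  have der: "((\<lambda>t. ?D (z + t *\<^sub>R (u - z))) has_real_derivative - ((u - z) \<bullet> hess f z (y - z))) (at 0)"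
    if "z \<in> interior (edom f)" for u
    using bregman_directional_derivative[OF G h y that, of 0 "u - z"] by (simp add: inner_commute)
  have conv: "convex_on (interior (edom f)) ?D"
    unfolding convex_on_def
  proof (intro conjI ballI allI impI)
    show "convex (interior (edom f))"
      using sc by (simp add: strictly_convex_on_def)
    fix a b and r s :: real
    assume ab: "a \<in> interior (edom f)" "b \<in> interior (edom f)" "0 \<le> r" "0 \<le> s" "r + s = 1"
    \<comment> \<open>Joint convexity is restricted to pairs with first component \<open>y\<close>,
      which \<open>r + s = 1\<close> keeps fixed.\<close>
    have "convex_on (interior (edom f) \<times> interior (edom f)) (\<lambda>(x, y). real_of_ereal (bregman f x y))"
      using f by (simp add: allows_forward_proj_def)
    then have "(\<lambda>(x, y). real_of_ereal (bregman f x y)) (r *\<^sub>R (y, a) + s *\<^sub>R (y, b))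
        \<le> r * (\<lambda>(x, y). real_of_ereal (bregman f x y)) (y, a)
          + s * (\<lambda>(x, y). real_of_ereal (bregman f x y)) (y, b)"
      using ab y unfolding convex_on_def by blast
    moreover have "r *\<^sub>R y + s *\<^sub>R y = y"
      using ab(5) by (metis scaleR_left_distrib scaleR_one)
    ultimately show "?D (r *\<^sub>R a + s *\<^sub>R b) \<le> r * ?D a + s * ?D b"
      by simp
  qed
  show ?thesis
  proof
    assume "fproj f U y = {z}"
    then have "z \<in> fproj f U y" by simp
    then have z: "z \<in> U" "z \<in> interior (edom f)" and min: "\<And>c. c \<in> U \<Longrightarrow> bregman f y z \<le> bregman f y c"
      by (auto simp: fproj_def)
    have "(u - z) \<bullet> hess f z (y - z) = 0" if "u \<in> U" for u
    proof -
      have "- ((u - z) \<bullet> hess f z (y - z)) = 0"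
      proof (rule affine_minimiser_stationary[OF U open_interior _ that _ der[OF z(2)]])
        show "?D z \<le> ?D w" if "w \<in> U \<inter> interior (edom f)" for w
          using min[of w] fin[of w] fin[of z] that z by (metis IntD1 IntD2 ereal_less_eq(3))
      qed (use z in auto)
      then show ?thesis by simp
    qed
    then show "z \<in> U \<inter> interior (edom f) \<and> (\<forall>u\<in>U. (u - z) \<bullet> hess f z (y - z) = 0)"
      using z by blast
  next
    assume a: "z \<in> U \<inter> interior (edom f) \<and> (\<forall>u\<in>U. (u - z) \<bullet> hess f z (y - z) = 0)"
    then have z: "z \<in> U" "z \<in> interior (edom f)" by auto
    have min: "?D z \<le> ?D u" if "u \<in> U" "u \<in> interior (edom f)" for u
      using convex_on_directional_derivative_le[OF conv z(2) that(2) der[OF z(2)]] a that by simp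
    have zf: "z \<in> fproj f U y"
    proof -
      have "bregman f y z \<le> bregman f y c" if "c \<in> U" for c
      proof (cases "c \<in> interior (edom f)")
        case True
        then show ?thesis
          using min[OF that True] fin[OF True] fin[OF z(2)] by (metis ereal_less_eq(3))
      next
        case False
        then show ?thesis
          using bregman_eq_infinity[OF G] by simp
      qed
      then show ?thesis
        using z by (simp add: fproj_def)
    qed
    moreover have "u = z" if "u \<in> fproj f U y" for u
    proof (rule ccontr)
      assume "u \<noteq> z"
      have u: "u \<in> U" "u \<in> interior (edom f)" "bregman f y u \<le> bregman f y z"
        using that z by (auto simp: fproj_def)
      have "?D u \<le> ?D z"
        using u fin[OF u(2)] fin[OF z(2)] by (metis ereal_less_eq(3))
      moreover have m: "midpoint u z \<in> U" "midpoint u z \<in> interior (edom f)"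
        using convex_midpoint_mem affine_imp_convex[OF U] convex_on_imp_convex[OF conv] u z by blast+
      moreover have "?D (midpoint u z) < (?D u + ?D z) / 2"
        using strictly_convex_on_midpoint[OF sc u(2) z(2) \<open>u \<noteq> z\<close> fin[OF u(2)] fin[OF z(2)] fin[OF m(2)]] .
      ultimately show False
        using min[OF m] by simp
    qed
    ultimately show "fproj f U y = {z}"
      by blast
  qed
qed

text \<open>At a point \<open>u\<close> of \<open>edom f\<close> outside its interior,
  \<open>bregman f u u\<close> is infinite by convention while \<open>bregman f u y\<close> is
  finite, so the identity fails there; hence the restricted range. Off \<open>edom f\<close> both
  sides are infinite.\<close>

lemma affine_bregman2_iff:
  assumes G: "f \<in> Gamma0" and h: "hess_exists_continuous_on (interior (edom f)) f"
    and U: "affine U" and y: "y \<in> interior (edom f)" and z: "z \<in> U \<inter> interior (edom f)"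
  shows "(\<forall>u \<in> U - (edom f - interior (edom f)).
            bregman f u y = bregman f u z + bregman2 f (u, u) (y, z)) \<longleftrightarrow>
    (\<forall>u\<in>U. (u - z) \<bullet> hess f z (y - z) = 0)"
proof
  assume a: "\<forall>u \<in> U - (edom f - interior (edom f)).
            bregman f u y = bregman f u z + bregman2 f (u, u) (y, z)"
  show "\<forall>u\<in>U. (u - z) \<bullet> hess f z (y - z) = 0"
  proof
    fix u assume u: "u \<in> U"
    show "(u - z) \<bullet> hess f z (y - z) = 0"
    proof (rule homogeneous_vanishing_on_affine[OF U open_interior z u])
      fix w assume "w \<in> U \<inter> interior (edom f)"
      then show "(w - z) \<bullet> hess f z (y - z) = 0"
        using a bregman_bregman2[OF G h y] z by blast
    qed simp
  qed
next
  assume a: "\<forall>u\<in>U. (u - z) \<bullet> hess f z (y - z) = 0"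
  show "\<forall>u \<in> U - (edom f - interior (edom f)).
            bregman f u y = bregman f u z + bregman2 f (u, u) (y, z)"
  proof
    fix u assume u: "u \<in> U - (edom f - interior (edom f))"
    show "bregman f u y = bregman f u z + bregman2 f (u, u) (y, z)"
    proof (cases "u \<in> edom f")
      case True
      then show ?thesis
        using a u bregman_bregman2[OF G h y] z by blast
    next
      case False
      have "(y, z) \<in> interior (edom (\<lambda>(x, y). bregman f x y))"
        using y z by (simp add: edom_bregman[OF G] interior_Times)
      then have "bregman2 f (u, u) (y, z) = \<infinity>"
        using False z bregman_eq_infinity[OF G] bregman_ereal[OF G interior_edom[OF y], of z]
        by (simp add: bregman2_def bregman_def[of "\<lambda>(x, y). bregman f x y"])
      then show ?thesis
        using bregman_eq_infinity[OF G] False by simp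
    qed
  qed
qed

theorem theorem2p9:
  fixes f :: "'a::{real_inner, complete_space} \<Rightarrow> ereal"
    and U L :: "'a set" and y z :: 'a
  assumes "f \<in> Gamma0" and "legendre f"
    and "affine U" and "closed U" and "U \<inter> interior (edom f) \<noteq> {}"
    and "subspace L" and "closed L" and "L \<inter> interior (edom f) \<noteq> {}"
    and "y \<in> interior (edom f)"
  shows
    "((bproj f U y = {z} \<longleftrightarrow>
         z \<in> U \<inter> interior (edom f) \<and> (\<forall>u\<in>U. (grad f y - grad f z) \<bullet> (u - z) = 0)) \<and>
      (bproj f U y = {z} \<longleftrightarrow>
         z \<in> U \<inter> interior (edom f) \<and>
         (\<forall>u\<in>U. bregman f u y = bregman f u z + bregman f z y)))
   \<and> (bproj f L y = {z} \<longleftrightarrow>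
         z \<in> L \<inter> interior (edom f) \<and> grad f y - grad f z \<in> L\<^sup>\<bottom>)
   \<and> ((\<exists>B::'a set. finite B \<and> span B = UNIV) \<and> open (edom (fenchel_conj f)) \<and>
        allows_forward_proj f \<longrightarrow>
      (fproj f U y = {z} \<longleftrightarrow>
         z \<in> U \<inter> interior (edom f) \<and> (\<forall>u\<in>U. (u - z) \<bullet> hess f z (y - z) = 0)) \<and>
      (fproj f U y = {z} \<longleftrightarrow>
         z \<in> U \<inter> interior (edom f) \<and>
         (\<forall>u \<in> U - (edom f - interior (edom f)).
            bregman f u y = bregman f u z + bregman2 f (u, u) (y, z))))
   \<and> ((\<exists>B::'a set. finite B \<and> span B = UNIV) \<and> open (edom (fenchel_conj f)) \<and>
        allows_forward_proj f \<longrightarrow>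
      (fproj f L y = {z} \<longleftrightarrow>
         z \<in> L \<inter> interior (edom f) \<and> hess f z (y - z) \<in> L\<^sup>\<bottom>))"
proof -
  note f = \<open>f \<in> Gamma0\<close> and leg = \<open>legendre f\<close> and U = \<open>affine U\<close> and y = \<open>y \<in> interior (edom f)\<close>
  \<comment> \<open>The claims on \<open>L\<close> are instances of the affine ones, with
    \<open>subspace_shift_annihilator\<close> rewriting the orthogonality.\<close>
  have L: "affine L"
    using \<open>subspace L\<close> by (rule subspace_imp_affine)
  note bU = bproj_affine_iff[OF leg U \<open>U \<inter> interior (edom f) \<noteq> {}\<close> y, of z]
  note bL = bproj_affine_iff[OF leg L \<open>L \<inter> interior (edom f) \<noteq> {}\<close> y, of z]
  have i: "bproj f U y = {z} \<longleftrightarrow> z \<in> U \<inter> interior (edom f) \<and>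
      (\<forall>u\<in>U. bregman f u y = bregman f u z + bregman f z y)"
    using bU affine_three_point_iff[OF f U y] by blast
  have ii: "bproj f L y = {z} \<longleftrightarrow> z \<in> L \<inter> interior (edom f) \<and> grad f y - grad f z \<in> L\<^sup>\<bottom>"
    unfolding bL using subspace_shift_annihilator[OF \<open>subspace L\<close>, of z "grad f y - grad f z"]
    by (auto simp: inner_commute)
  have iii: "fproj f U y = {z} \<longleftrightarrow> z \<in> U \<inter> interior (edom f) \<and>
      (\<forall>u \<in> U - (edom f - interior (edom f)).
            bregman f u y = bregman f u z + bregman2 f (u, u) (y, z))"
    if a: "allows_forward_proj f"
  proof -
    have "hess_exists_continuous_on (interior (edom f)) f"
      using a by (simp add: allows_forward_proj_def)
    then show ?thesis
      using fproj_affine_iff[OF a U y, of z] affine_bregman2_iff[OF f _ U y] by blast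
  qed
  have iv: "fproj f L y = {z} \<longleftrightarrow> z \<in> L \<inter> interior (edom f) \<and> hess f z (y - z) \<in> L\<^sup>\<bottom>"
    if "allows_forward_proj f"
    unfolding fproj_affine_iff[OF that L y]
    using subspace_shift_annihilator[OF \<open>subspace L\<close>] by blast
  show ?thesis
    by (intro conjI impI bU i ii iii iv fproj_affine_iff[OF _ U y]; elim conjE; assumption)
qed

end
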